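(* Let $G$ be a simple subcubic graph of order $n$ (i.e., every vertex has degree at most $3$) such that $G$ contains a subgraph isomorphic to the complete bipartite graph $K_{2,3}$. Then $R(G)\le 1$.
   Context: For a simple graph $G$ of order $n$, let $\lambda_1(G)\ge \lambda_2(G)\ge\dots\ge\lambda_n(G)$ be the eigenvalues of its adjacency matrix, listed with multiplicity. The HL-index of $G$ is $R(G)=\max\{|\lambda_h(G)|,|\lambda_l(G)|\}$, where $h=\lfloor (n+1)/2\rfloor$ and $l=\lceil (n+1)/2\rceil$. *)

theory Defs
  imports "Graph_Theory.Kuratowski" "Jordan_Normal_Form.Char_Poly"
begin

text \<open>
  Simple graphs are the finite symmetric digraphs without loops and parallel arcs of the locale
  \<^locale>\<open>graph\<close>; an edge \<open>uv\<close> is the pair of arcs \<open>(u, v)\<close> and \<open>(v, u)\<close>, so the degree of a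
  vertex is its out-degree.
\<close>

definition subcubic :: "('a, 'b) pre_digraph \<Rightarrow> bool" where
  "subcubic G \<longleftrightarrow> (\<forall>v \<in> verts G. out_degree G v \<le> 3)"

definition adjacency_matrix :: "('a, 'b) pre_digraph \<Rightarrow> 'a list \<Rightarrow> real mat" where
  "adjacency_matrix G vs =
     mat (length vs) (length vs) (\<lambda>(i, j). if vs ! i \<rightarrow>\<^bsub>G\<^esub> vs ! j then 1 else 0)"

definition eigenvalue_list :: "real mat \<Rightarrow> real list" where
  "eigenvalue_list A = rev (sorted_list_of_multiset (proots (char_poly A)))"

text \<open>
  The numbering of the vertices is arbitrary; by \<open>char_poly_adjacency_matrix_unique\<close> below
  the eigenvalues do not depend on it.
\<close>

definition graph_eigenvalues :: "('a, 'b) pre_digraph \<Rightarrow> real list" where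
  "graph_eigenvalues G =
     eigenvalue_list (adjacency_matrix G (SOME vs. distinct vs \<and> set vs = verts G))"

text \<open>Eigenvalues are numbered from 1, in decreasing order.\<close>

definition graph_eigenvalue :: "nat \<Rightarrow> ('a, 'b) pre_digraph \<Rightarrow> real" where
  "graph_eigenvalue i G = graph_eigenvalues G ! (i - 1)"

definition HL_index :: "('a, 'b) pre_digraph \<Rightarrow> real" where
  "HL_index G =
     (let n = card (verts G);
          h = nat \<lfloor>(real n + 1) / 2\<rfloor>;
          l = nat \<lceil>(real n + 1) / 2\<rceil>
      in max \<bar>graph_eigenvalue h G\<bar> \<bar>graph_eigenvalue l G\<bar>)"


lemma adjacency_matrix_carrier:
  "adjacency_matrix G vs \<in> carrier_mat (length vs) (length vs)"
  by (simp add: adjacency_matrix_def)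

lemma sum_nth_eq:
  fixes f :: "'a \<Rightarrow> real"
  assumes "distinct vs" "x \<in> set vs"
  shows "(\<Sum>k = 0..<length vs. if x = vs ! k then f (vs ! k) else 0) = f x"
proof -
  have "(\<Sum>k = 0..<length vs. if x = vs ! k then f (vs ! k) else 0)
      = (\<Sum>y \<in> set vs. if x = y then f y else 0)"
    using bij_betw_nth[OF assms(1), of "{0..<length vs}" "set vs"]
    by (intro sum.reindex_bij_betw) (auto simp: atLeast0LessThan)
  also have "\<dots> = f x"
    using assms(2) by (subst sum.delta') auto
  finally show ?thesis .
qed

lemma char_poly_adjacency_matrix_unique:
  assumes vs: "distinct vs" "set vs = verts G" and ws: "distinct ws" "set ws = verts G"
  shows "char_poly (adjacency_matrix G vs) = char_poly (adjacency_matrix G ws)"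
proof -
  define n where "n = length vs"
  have len: "length ws = n"
    using distinct_card[OF vs(1)] distinct_card[OF ws(1)] vs(2) ws(2) by (simp add: n_def)
  have n: "length vs = n" by (simp add: n_def)
  define A where "A x y = (if x \<rightarrow>\<^bsub>G\<^esub> y then 1 else 0 :: real)" for x y
  define C where "C xs ys = (mat n n (\<lambda>(i, j). if xs ! i = ys ! j then 1 else 0) :: real mat)"
    for xs ys :: "'a list"
  have inverse: "C xs ys * C ys xs = 1\<^sub>m n"
    if xs: "distinct xs" "set xs = verts G" "length xs = n"
      and ys: "distinct ys" "set ys = verts G" "length ys = n" for xs ys
  proof (rule eq_matI)
    fix i j assume "i < dim_row (1\<^sub>m n :: real mat)" "j < dim_col (1\<^sub>m n :: real mat)"
    hence ij: "i < n" "j < n" by auto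
    have "(C xs ys * C ys xs) $$ (i, j)
        = (\<Sum>k = 0..<length ys. if xs ! i = ys ! k then (if ys ! k = xs ! j then 1 else 0) else 0)"
      using ij by (auto simp: C_def scalar_prod_def ys(3) intro!: sum.cong)
    also have "\<dots> = (if xs ! i = xs ! j then 1 else 0)"
      using ij xs ys nth_mem by (intro sum_nth_eq[OF ys(1)]) fastforce
    also have "\<dots> = 1\<^sub>m n $$ (i, j)"
      using ij xs by (simp add: nth_eq_iff_index_eq)
    finally show "(C xs ys * C ys xs) $$ (i, j) = 1\<^sub>m n $$ (i, j)" .
  qed (auto simp: C_def)
  have AV: "adjacency_matrix G xs = mat n n (\<lambda>(i, j). A (xs ! i) (xs ! j))"
    if "length xs = n" for xs
    using that by (simp add: adjacency_matrix_def A_def)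
  have left: "adjacency_matrix G vs * C vs ws = mat n n (\<lambda>(i, j). A (vs ! i) (ws ! j))"
  proof (rule eq_matI, goal_cases)
    case (1 i j)
    hence ij: "i < n" "j < n" by auto
    have "(adjacency_matrix G vs * C vs ws) $$ (i, j)
        = (\<Sum>k = 0..<length vs. if ws ! j = vs ! k then A (vs ! i) (vs ! k) else 0)"
      using ij by (auto simp: AV n C_def scalar_prod_def intro!: sum.cong)
    also have "\<dots> = A (vs ! i) (ws ! j)"
      using ij ws vs len nth_mem by (intro sum_nth_eq[OF vs(1)]) fastforce
    finally show ?case using ij by simp
  qed (auto simp: C_def AV n)
  have right: "C vs ws * adjacency_matrix G ws = mat n n (\<lambda>(i, j). A (vs ! i) (ws ! j))"
  proof (rule eq_matI, goal_cases)
    case (1 i j)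
    hence ij: "i < n" "j < n" by auto
    have "(C vs ws * adjacency_matrix G ws) $$ (i, j)
        = (\<Sum>k = 0..<length ws. if vs ! i = ws ! k then A (ws ! k) (ws ! j) else 0)"
      using ij by (auto simp: AV len C_def scalar_prod_def intro!: sum.cong)
    also have "\<dots> = A (vs ! i) (ws ! j)"
      using ij ws vs n nth_mem by (intro sum_nth_eq[OF ws(1)]) fastforce
    finally show ?case using ij by simp
  qed (auto simp: C_def AV len)
  have carrier: "C xs ys \<in> carrier_mat n n" "adjacency_matrix G vs \<in> carrier_mat n n"
    "adjacency_matrix G ws \<in> carrier_mat n n" for xs ys
    using n len by (auto simp: C_def adjacency_matrix_def)
  have "adjacency_matrix G vs = adjacency_matrix G vs * (C vs ws * C ws vs)"
    using inverse[OF vs n ws len] carrier by simp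
  also have "\<dots> = C vs ws * adjacency_matrix G ws * C ws vs"
    using left right
    by (simp add: assoc_mult_mat[OF carrier(2) carrier(1) carrier(1), symmetric])
  finally have "similar_mat (adjacency_matrix G vs) (adjacency_matrix G ws)"
    using carrier inverse[OF vs n ws len] inverse[OF ws len vs n]
    by (intro similar_matI[of _ _ "C vs ws" "C ws vs" n]) auto
  thus ?thesis by (rule char_poly_similar)
qed

lemma (in fin_digraph) graph_eigenvalues_enum:
  assumes "distinct vs" "set vs = verts G"
  shows "graph_eigenvalues G = eigenvalue_list (adjacency_matrix G vs)"
proof -
  have "\<exists>ws. distinct ws \<and> set ws = verts G" using assms by blast
  from someI_ex[OF this] show ?thesis
    unfolding graph_eigenvalues_def eigenvalue_list_def
    using char_poly_adjacency_matrix_unique[OF _ _ assms] by metis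
qed

lemma symmetric_eigenvalue_real:
  fixes A :: "real mat"
  assumes A: "A \<in> carrier_mat n n" and sym: "transpose_mat A = A"
    and z: "poly (map_poly complex_of_real (char_poly A)) z = 0"
  shows "z \<in> \<real>"
proof -
  interpret of_real_hom: comm_ring_hom "complex_of_real" by unfold_locales auto
  let ?B = "map_mat complex_of_real A"
  have B: "?B \<in> carrier_mat n n" using A by simp
  have "poly (char_poly ?B) z = 0"
    using z by (simp add: of_real_hom.char_poly_hom[OF A])
  then obtain v where v: "v \<in> carrier_vec n" "v \<noteq> 0\<^sub>v n" "?B *\<^sub>v v = z \<cdot>\<^sub>v v"
    using eigenvalue_root_char_poly[OF B] B unfolding eigenvalue_def eigenvector_def by auto
  have entry: "(\<Sum>j<n. of_real (A $$ (i, j)) * v $ j) = z * v $ i" if "i < n" for i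
  proof -
    have "(?B *\<^sub>v v) $ i = (\<Sum>j<n. of_real (A $$ (i, j)) * v $ j)"
      using that A v(1) by (auto simp: scalar_prod_def atLeast0LessThan intro!: sum.cong)
    thus ?thesis using v that by simp
  qed
  have symA: "A $$ (i, j) = A $$ (j, i)" if "i < n" "j < n" for i j
    using sym A that by (metis carrier_matD index_transpose_mat(1))
  define s where "s = (\<Sum>i<n. (cmod (v $ i))\<^sup>2)"
  define Q where "Q = (\<Sum>i<n. cnj (v $ i) * (\<Sum>j<n. of_real (A $$ (i, j)) * v $ j))"
  have Q1: "Q = z * of_real s"
    unfolding Q_def s_def of_real_sum sum_distrib_left[of z]
  proof (intro sum.cong refl)
    fix i assume "i \<in> {..<n}"
    thus "cnj (v $ i) * (\<Sum>j<n. of_real (A $$ (i, j)) * v $ j) = z * of_real ((cmod (v $ i))\<^sup>2)"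
      by (simp add: entry complex_norm_square del: of_real_power)
  qed
  have "cnj Q = (\<Sum>i<n. \<Sum>j<n. v $ i * of_real (A $$ (i, j)) * cnj (v $ j))"
    by (simp add: Q_def sum_distrib_left mult_ac)
  also have "\<dots> = (\<Sum>j<n. \<Sum>i<n. v $ i * of_real (A $$ (i, j)) * cnj (v $ j))"
    by (rule sum.swap)
  also have "\<dots> = Q"
    unfolding Q_def sum_distrib_left by (intro sum.cong refl) (auto simp: symA mult_ac)
  finally have "cnj z * of_real s = z * of_real s" by (simp add: Q1)
  moreover have "s \<noteq> 0"
  proof
    assume "s = 0"
    hence "\<forall>i<n. v $ i = 0" by (auto simp: s_def sum_nonneg_eq_0_iff)
    hence "v = 0\<^sub>v n" using v(1) by auto
    thus False using v(2) by simp
  qed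
  ultimately show ?thesis by (simp add: Reals_cnj_iff)
qed

lemma size_proots_real_rooted:
  fixes p :: "real poly"
  assumes "p \<noteq> 0" "\<And>z. poly (map_poly complex_of_real p) z = 0 \<Longrightarrow> z \<in> \<real>"
  shows "size (proots p) = degree p"
proof -
  interpret hom: map_poly_comm_ring_hom complex_of_real by unfold_locales auto
  show ?thesis using assms
  proof (induction "degree p" arbitrary: p)
    case 0
    then show ?case by (metis degree_eq_zeroE proots_const size_empty)
  next
    case (Suc d)
    have "degree (map_poly complex_of_real p) \<noteq> 0" using Suc.hyps(2) by simp
    then obtain z where z: "poly (map_poly complex_of_real p) z = 0"
      using fundamental_theorem_of_algebra_alt[of "map_poly complex_of_real p"]
      by (metis degree_pCons_0)
    with Suc.prems obtain r where "z = of_real r" by (auto elim: Reals_cases)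
    with z have "poly p r = 0" by simp
    then obtain q where q: "p = [:-r, 1:] * q" by (auto simp: poly_eq_0_iff_dvd)
    hence q0: "q \<noteq> 0" using Suc.prems by auto
    have deg: "degree p = Suc (degree q)" using q0 unfolding q by (subst degree_mult_eq) auto
    have "size (proots q) = degree q"
    proof (rule Suc.hyps(1))
      fix z assume "poly (map_poly complex_of_real q) z = 0"
      hence "poly (map_poly complex_of_real p) z = 0" by (simp only: q hom.hom_mult poly_mult mult_zero_right)
      thus "z \<in> \<real>" by (rule Suc.prems)
    qed (use deg Suc.hyps(2) q0 in auto)
    moreover have "proots p = {#r#} + proots q"
      using q0 unfolding q by (subst proots_mult) auto
    ultimately show ?case using deg by simp
  qed
qed

lemma (in graph) length_graph_eigenvalues: "length (graph_eigenvalues G) = card (verts G)"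
proof -
  obtain vs where vs: "distinct vs" "set vs = verts G"
    using finite_distinct_list[OF finite_verts] by auto
  let ?A = "adjacency_matrix G vs"
  have c: "?A \<in> carrier_mat (length vs) (length vs)" by (rule adjacency_matrix_carrier)
  have "transpose_mat ?A = ?A"
    using sym_arcs unfolding symmetric_def adjacency_matrix_def
    by (intro eq_matI) (auto dest: symD)
  hence "size (proots (char_poly ?A)) = degree (char_poly ?A)"
    using symmetric_eigenvalue_real[OF c] degree_monic_char_poly[OF c]
    by (intro size_proots_real_rooted) auto
  thus ?thesis
    using degree_monic_char_poly[OF c] distinct_card[OF vs(1)] vs(2)
    by (simp add: graph_eigenvalues_enum[OF vs] eigenvalue_list_def
        flip: size_mset)
qed

end

theory Submission
  imports Defs "Jordan_Normal_Form.Schur_Decomposition"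
begin

text \<open>
  By Courant--Fischer it suffices to find a subspace of dimension greater than \<open>n/2\<close> on which the
  quadratic form of the adjacency matrix is bounded in absolute value by the squared norm. A set
  \<open>S\<close> of vertices that induces a graph of maximum degree at most 1 spans such a subspace, and one
  further dimension is available if two vertices outside \<open>S\<close> have the same neighbours in \<open>S\<close>.

  Let \<open>U \<union> V\<close> be the vertex set of the \<open>K\<^bsub>2,3\<^esub>\<close>, and let \<open>(A, B)\<close> be a maximum cut of the remaining
  graph with \<open>|A| \<ge> |B|\<close>; each side induces maximum degree at most 1, and the vertices of \<open>U\<close> have no
  neighbours outside \<open>V\<close>. If two vertices \<open>x\<close>, \<open>y\<close> of \<open>V\<close> have no neighbour in \<open>A\<close>, take
  \<open>S = A \<union> U\<close> with the twins \<open>x\<close>, \<open>y\<close>. Otherwise two vertices of \<open>V\<close> have their only outer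
  neighbour in \<open>A\<close>, and \<open>S = B \<union> V\<close> with the two vertices of \<open>U\<close> as twins works, unless the
  third vertex of \<open>V\<close> is adjacent to an end of an edge inside \<open>B\<close>; this end can then be moved to
  \<open>A\<close> without decreasing the cut, which makes \<open>A \<union> U\<close> large enough by itself. (If \<open>A\<close> exceeds \<open>B\<close>
  by at least 2, then already \<open>A \<union> U\<close> is large enough.)
\<close>

subsection \<open>Eigenvalues of symmetric matrices\<close>

text \<open>Padding the equations with zero rows gives a square matrix whose transpose annihilates a
  unit vector; hence its determinant vanishes and it has a nonzero kernel vector.\<close>

lemma underdetermined_system:
  fixes rs :: "'k :: field vec list"
  assumes "set rs \<subseteq> carrier_vec n" "length rs < n"
  obtains x where "x \<in> carrier_vec n" "x \<noteq> 0\<^sub>v n" "\<And>r. r \<in> set rs \<Longrightarrow> r \<bullet> x = 0"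
proof -
  define M where "M = mat_of_rows n (rs @ replicate (n - length rs) (0\<^sub>v n))"
  have M: "M \<in> carrier_mat n n"
    using assms(2) by (auto simp: M_def)
  have row: "row M i = (rs @ replicate (n - length rs) (0\<^sub>v n)) ! i" if "i < n" for i
    unfolding M_def using that assms by (intro mat_of_rows_row) (auto simp: nth_append intro: nth_mem subsetD)
  \<comment> \<open>Position \<open>length rs\<close> holds the first of the zero rows.\<close>
  have "transpose_mat M *\<^sub>v unit_vec n (length rs) = 0\<^sub>v n"
  proof (rule eq_vecI)
    fix i assume "i < dim_vec (0\<^sub>v n :: 'k vec)"
    hence i: "i < n" by simp
    have "(transpose_mat M *\<^sub>v unit_vec n (length rs)) $ i = row M (length rs) $ i"
      using i M assms(2) by (simp add: col_transpose)
    thus "(transpose_mat M *\<^sub>v unit_vec n (length rs)) $ i = 0\<^sub>v n $ i"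
      using i row[OF assms(2)] assms(2) by (simp add: nth_append)
  qed (use M in auto)
  hence "det (transpose_mat M) = 0"
    using M assms(2) by (subst det_0_iff_vec_prod_zero_field[of _ n]) (auto intro!: exI[of _ "unit_vec n (length rs)"])
  hence "det M = 0" using det_transpose[OF M] by simp
  then obtain x where x: "x \<in> carrier_vec n" "x \<noteq> 0\<^sub>v n" "M *\<^sub>v x = 0\<^sub>v n"
    using det_0_iff_vec_prod_zero_field[OF M] by auto
  moreover have "r \<bullet> x = 0" if "r \<in> set rs" for r
  proof -
    from that obtain i where i: "i < length rs" "r = rs ! i" by (auto simp: in_set_conv_nth)
    have "(M *\<^sub>v x) $ i = r \<bullet> x" using row[of i] i assms(2) M by (simp add: nth_append)
    thus ?thesis using x(3) i assms(2) by simp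
  qed
  ultimately show ?thesis using that by blast
qed

text \<open>Gram--Schmidt applied to a basis that starts with \<open>v\<close> leaves
  \<open>v\<close> in place; the normalised vectors are the columns of \<open>W\<close>, and
  \<open>r\<close> is the normalising factor of \<open>v\<close>.\<close>

lemma orthogonal_matrix_with_first_column:
  fixes v :: "real vec"
  assumes v: "v \<in> carrier_vec n" "v \<noteq> 0\<^sub>v n"
  obtains W r where "W \<in> carrier_mat n n" "transpose_mat W * W = 1\<^sub>m n" "col W 0 = r \<cdot>\<^sub>v v"
proof -
  interpret cof_vec_space n "TYPE(real)" .
  define ws where "ws = gram_schmidt n (basis_completion v)"
  note b = basis_completion[OF v]
  have n: "n > 0" using v by (cases n) auto
  have ws: "set ws \<subseteq> carrier_vec n" "corthogonal ws" "length ws = n"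
    using gram_schmidt_result[OF b(2,4,5) ws_def] b(6) by auto
  obtain vs where "basis_completion v = v # vs" using b(6,7) n by (cases "basis_completion v") auto
  hence hd: "ws ! 0 = v" using gram_schmidt_hd[OF v(1), of vs] ws(3) n
    by (subst hd_conv_nth[symmetric]) (auto simp: ws_def)
  have wsc: "ws ! i \<in> carrier_vec n" if "i < n" for i using ws that by auto
  have orth: "ws ! i \<bullet> ws ! j = 0 \<longleftrightarrow> i \<noteq> j" if "i < n" "j < n" for i j
    using corthogonalD[OF ws(2), of i j] that ws(3) by simp
  define s where "s i = 1 / sqrt (ws ! i \<bullet> ws ! i)" for i
  define us where "us = map (\<lambda>i. s i \<cdot>\<^sub>v ws ! i) [0..<n]"
  define W where "W = mat_of_cols n us"
  have W: "W \<in> carrier_mat n n" by (auto simp: W_def us_def)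
  have col: "col W i = s i \<cdot>\<^sub>v ws ! i" if "i < n" for i
    unfolding W_def using that wsc by (subst col_mat_of_cols) (auto simp: us_def)
  have "transpose_mat W * W = 1\<^sub>m n"
  proof (rule eq_matI)
    fix i j assume "i < dim_row (1\<^sub>m n :: real mat)" "j < dim_col (1\<^sub>m n :: real mat)"
    hence ij: "i < n" "j < n" by auto
    have "(transpose_mat W * W) $$ (i, j) = s i * s j * (ws ! i \<bullet> ws ! j)"
      using ij W wsc[of i] wsc[of j] by (simp add: col)
    also have "\<dots> = 1\<^sub>m n $$ (i, j)"
    proof (cases "i = j")
      case True
      have "ws ! i \<bullet> ws ! i \<ge> 0"
        by (auto simp: scalar_prod_def intro!: sum_nonneg)
      moreover have "ws ! i \<bullet> ws ! i \<noteq> 0" using orth[of i i] ij by simp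
      ultimately show ?thesis using True ij by (simp add: s_def)
    qed (use orth[OF ij] ij in auto)
    finally show "(transpose_mat W * W) $$ (i, j) = 1\<^sub>m n $$ (i, j)" .
  qed (use W in auto)
  with W show ?thesis using col[of 0] hd n by (intro that) auto
qed

lemma transpose_congruence:
  fixes A :: "'k :: comm_semiring_0 mat"
  assumes "A \<in> carrier_mat n n" "P \<in> carrier_mat n m" "transpose_mat A = A"
  shows "transpose_mat (transpose_mat P * A * P) = transpose_mat P * A * P"
proof -
  have "transpose_mat (transpose_mat P * A * P) = transpose_mat P * (transpose_mat A * P)"
    using assms by (subst transpose_mult[of _ m n]) (auto simp: transpose_mult[of _ m n _ n])
  thus ?thesis using assms by (subst assoc_mult_mat[of _ m n _ n]) auto
qed

text \<open>The spectral theorem with the eigenvalues in the prescribed order, by deflation: an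
  orthogonal change of basis moves an eigenvector for the head of \<open>es\<close> to the first
  place, and the induction hypothesis applies to the complementary block.\<close>

lemma symmetric_orthogonal_diagonalization:
  fixes A :: "real mat"
  assumes "A \<in> carrier_mat n n" "transpose_mat A = A" "char_poly A = (\<Prod>e\<leftarrow>es. [:-e, 1:])"
  obtains P where "P \<in> carrier_mat n n" "transpose_mat P * P = 1\<^sub>m n"
    "transpose_mat P * A * P = mat n n (\<lambda>(i, j). if i = j then es ! i else 0)"
proof -
  have "\<exists>P. P \<in> carrier_mat n n \<and> transpose_mat P * P = 1\<^sub>m n \<and>
    transpose_mat P * A * P = mat n n (\<lambda>(i, j). if i = j then es ! i else 0)"
    using assms
  proof (induction es arbitrary: n A)
    case Nil
    hence "n = 0" using degree_monic_char_poly[of A n] by auto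
    thus ?case using Nil by (intro exI[of _ A]) (auto intro!: eq_matI)
  next
    case (Cons e es)
    note A = Cons.prems(1)
    have "poly (char_poly A) e = 0" using Cons.prems(3) by simp
    then obtain v where v: "v \<in> carrier_vec n" "v \<noteq> 0\<^sub>v n" "A *\<^sub>v v = e \<cdot>\<^sub>v v"
      using eigenvalue_root_char_poly[OF A] A unfolding eigenvalue_def eigenvector_def by auto
    obtain m where n: "n = Suc m" using v(1,2) by (cases n) auto
    obtain W r where W: "W \<in> carrier_mat n n" "transpose_mat W * W = 1\<^sub>m n" "col W 0 = r \<cdot>\<^sub>v v"
      by (rule orthogonal_matrix_with_first_column[OF v(1,2)])
    have WW: "W * transpose_mat W = 1\<^sub>m n"
      using mat_mult_left_right_inverse[OF _ W(1,2)] W(1) by simp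
    define B where "B = transpose_mat W * A * W"
    have B: "B \<in> carrier_mat n n" "transpose_mat B = B"
      using A W(1) transpose_congruence[OF A W(1) Cons.prems(2)] by (simp_all only: B_def) auto
    have col0: "col B 0 = e \<cdot>\<^sub>v unit_vec n 0"
    proof -
      have u: "A *\<^sub>v col W 0 = e \<cdot>\<^sub>v col W 0"
        using v A by (simp add: W(3) mult_mat_vec smult_smult_assoc mult.commute)
      have WT: "transpose_mat W \<in> carrier_mat n n" and c: "col W 0 \<in> carrier_vec n" and n0: "0 < n"
        using W(1) n by (auto intro: carrier_vecI)
      have "col B 0 = transpose_mat W * A *\<^sub>v col W 0"
        unfolding B_def by (rule col_mult2[OF mult_carrier_mat[OF WT A] W(1) n0])
      also have "\<dots> = transpose_mat W *\<^sub>v (e \<cdot>\<^sub>v col W 0)"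
        by (simp only: assoc_mult_mat_vec[OF WT A c] u)
      also have "\<dots> = e \<cdot>\<^sub>v col (transpose_mat W * W) 0"
        by (simp only: col_mult2[OF WT W(1) n0] mult_mat_vec[OF WT c])
      finally show ?thesis using n by (simp add: W(2))
    qed
    define C where "C = mat m m (\<lambda>(i, j). B $$ (Suc i, Suc j))"
    let ?e = "mat 1 1 (\<lambda>_. e)"
    have C: "C \<in> carrier_mat m m" by (simp add: C_def)
    have Bcol: "B $$ (i, 0) = (if i = 0 then e else 0)" if "i < n" for i
      using arg_cong[OF col0, of "\<lambda>v. v $ i"] that B n by auto
    have Bsym: "B $$ (i, j) = B $$ (j, i)" if "i < n" "j < n" for i j
      using that B by (metis carrier_matD index_transpose_mat(1))
    \<comment> \<open>The first column of \<open>B\<close> is \<open>e\<close> times a unit vector,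
      and symmetry transfers its zeros to the first row.\<close>
    have block: "B = four_block_mat ?e (0\<^sub>m 1 m) (0\<^sub>m m 1) C"
    proof (rule eq_matI, goal_cases)
      case (1 i j)
      hence "i < n" "j < n" using C n by auto
      thus ?case
        using Bcol[of i] Bcol[of j] Bsym[of i j] n by (cases i; cases j) (auto simp: C_def)
    qed (use B n C in auto)
    have symC: "transpose_mat C = C"
      using Bsym n by (intro eq_matI) (auto simp: C_def)
    have "similar_mat B A"
      unfolding similar_mat_def similar_mat_wit_def B_def Let_def using A W WW
      by (intro exI[of _ "transpose_mat W"] exI[of _ W]) auto
    have "char_poly ?e * char_poly C = char_poly B"
      unfolding block by (rule char_poly_four_block_zeros_col[symmetric]) (use C in auto)
    also have "\<dots> = [:-e, 1:] * (\<Prod>e\<leftarrow>es. [:-e, 1:])"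
      unfolding char_poly_similar[OF \<open>similar_mat B A\<close>] Cons.prems(3) by simp
    finally have "char_poly ?e * char_poly C = [:-e, 1:] * (\<Prod>e\<leftarrow>es. [:-e, 1:])" .
    moreover have "char_poly ?e = [:-e, 1:]"
      by (simp add: char_poly_defs det_def sign_def)
    ultimately have "char_poly C = (\<Prod>e\<leftarrow>es. [:-e, 1:])"
      by (metis mult_cancel_left pCons_eq_0_iff zero_neq_one)
    then obtain Q where Q: "Q \<in> carrier_mat m m" "transpose_mat Q * Q = 1\<^sub>m m"
      "transpose_mat Q * C * Q = mat m m (\<lambda>(i, j). if i = j then es ! i else 0)"
      using Cons.IH[OF C symC] by blast
    \<comment> \<open>\<open>F\<close> keeps the eigenvector and rotates only its orthogonal
      complement.\<close>
    define F where "F = four_block_mat (1\<^sub>m 1) (0\<^sub>m 1 m) (0\<^sub>m m 1) Q"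
    have F: "F \<in> carrier_mat n n" using four_block_carrier_mat[OF one_carrier_mat[of 1] Q(1)] n by (simp add: F_def)
    have FT: "transpose_mat F = four_block_mat (1\<^sub>m 1) (0\<^sub>m 1 m) (0\<^sub>m m 1) (transpose_mat Q)"
      using Q(1) by (simp add: F_def transpose_four_block_mat[of _ 1 1 _ m _ m])
    have "transpose_mat F * F = four_block_mat (1\<^sub>m 1) (0\<^sub>m 1 m) (0\<^sub>m m 1) (1\<^sub>m m)"
      unfolding FT unfolding F_def using Q
      by (subst mult_four_block_mat[of _ 1 1 _ m _ m _ _ 1 _ m]) auto
    also have "\<dots> = 1\<^sub>m n" using n by (intro eq_matI) auto
    finally have FF: "transpose_mat F * F = 1\<^sub>m n" .
    have "transpose_mat F * B = four_block_mat ?e (0\<^sub>m 1 m) (0\<^sub>m m 1) (transpose_mat Q * C)"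
      unfolding FT block using Q(1) C by (subst mult_four_block_mat[of _ 1 1 _ m _ m _ _ 1 _ m]) auto
    hence "transpose_mat F * B * F = four_block_mat ?e (0\<^sub>m 1 m) (0\<^sub>m m 1) (transpose_mat Q * C * Q)"
      unfolding F_def using Q(1) C by (simp only:, subst mult_four_block_mat[of _ 1 1 _ m _ m _ _ 1 _ m]) auto
    also have "\<dots> = mat n n (\<lambda>(i, j). if i = j then (e # es) ! i else 0)"
      unfolding Q(3) using n by (intro eq_matI) (auto simp: nth_Cons' )
    finally have FBF: "transpose_mat F * B * F = mat n n (\<lambda>(i, j). if i = j then (e # es) ! i else 0)" .
    have T: "transpose_mat (W * F) = transpose_mat F * transpose_mat W"
      by (rule transpose_mult[OF W(1) F])
    have "transpose_mat (W * F) * (W * F) = transpose_mat F * (transpose_mat W * W) * F"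
      unfolding T using W(1) F by (simp add: assoc_mult_mat[of _ n n _ n _ n])
    moreover have "transpose_mat (W * F) * A * (W * F) = transpose_mat F * B * F"
      unfolding T B_def using W(1) F A by (simp add: assoc_mult_mat[of _ n n _ n _ n])
    ultimately show ?case
      using W F FF FBF by (intro exI[of _ "W * F"]) auto
  qed
  thus ?thesis using that by blast
qed

text \<open>The eigenvectors indexed by \<open>K\<close> span a space of dimension
  \<open>card K\<close>, so the fewer constraints \<open>cs\<close> leave a nonzero vector in it. On
  this space the quadratic form is a sum of squares weighted by the eigenvalues with index in
  \<open>K\<close>.\<close>

lemma courant_fischer_vector:
  fixes A :: "real mat"
  assumes A: "A \<in> carrier_mat n n" "transpose_mat A = A" "char_poly A = (\<Prod>e\<leftarrow>es. [:-e, 1:])"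
    and cs: "set cs \<subseteq> carrier_vec n" and K: "K \<subseteq> {..<n}" "length cs < card K"
  obtains v where "v \<in> carrier_vec n" "v \<bullet> v > 0" "\<And>c. c \<in> set cs \<Longrightarrow> c \<bullet> v = 0"
    "\<And>t. (\<And>i. i \<in> K \<Longrightarrow> t \<le> es ! i) \<Longrightarrow> t * (v \<bullet> v) \<le> v \<bullet> (A *\<^sub>v v)"
    "\<And>t. (\<And>i. i \<in> K \<Longrightarrow> es ! i \<le> t) \<Longrightarrow> v \<bullet> (A *\<^sub>v v) \<le> t * (v \<bullet> v)"
proof -
  obtain P where P: "P \<in> carrier_mat n n" "transpose_mat P * P = 1\<^sub>m n"
    "transpose_mat P * A * P = mat n n (\<lambda>(i, j). if i = j then es ! i else 0)"
    by (rule symmetric_orthogonal_diagonalization[OF A])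
  have PT: "transpose_mat P \<in> carrier_mat n n" using P(1) by simp
  \<comment> \<open>\<open>ks\<close> lists the coordinates in the eigenbasis that have to vanish.
    These \<open>n - card K\<close> equations and those from \<open>cs\<close> are together fewer
    than \<open>n\<close>.\<close>
  obtain ks where ks: "set ks = {..<n} - K" "distinct ks"
    using finite_distinct_list[of "{..<n} - K"] by auto
  have "length ks = n - card K"
    using distinct_card[OF ks(2)] ks(1) K(1) by (simp add: card_Diff_subset finite_subset)
  moreover have "card K \<le> n" using card_mono[OF _ K(1)] by simp
  ultimately have len: "length (map ((*\<^sub>v) (transpose_mat P)) cs @ map (unit_vec n) ks) < n"
    using K(2) by simp
  have car: "set (map ((*\<^sub>v) (transpose_mat P)) cs @ map (unit_vec n) ks) \<subseteq> carrier_vec n"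
    using cs PT by (auto intro!: mult_mat_vec_carrier)
  from underdetermined_system[OF car len] obtain y where y: "y \<in> carrier_vec n" "y \<noteq> 0\<^sub>v n"
    and orth: "\<And>r. r \<in> set (map ((*\<^sub>v) (transpose_mat P)) cs @ map (unit_vec n) ks) \<Longrightarrow> r \<bullet> y = 0"
    by blast
  have yc: "(transpose_mat P *\<^sub>v c) \<bullet> y = 0" if "c \<in> set cs" for c
    using that by (intro orth) auto
  have y0: "y $ i = 0" if "i < n" "i \<notin> K" for i
    using orth[of "unit_vec n i"] that ks(1) y(1) by simp
  define v where "v = P *\<^sub>v y"
  have v: "v \<in> carrier_vec n" using P(1) y(1) by (simp add: v_def)
  have adj: "v \<bullet> w = y \<bullet> (transpose_mat P *\<^sub>v w)" if "w \<in> carrier_vec n" for w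
    using transpose_vec_mult_scalar[OF PT that y(1)] by (simp add: v_def)
  have "transpose_mat P *\<^sub>v (P *\<^sub>v y) = y"
    using assoc_mult_mat_vec[OF PT P(1) y(1)] P(2) y(1) by simp
  hence "v \<bullet> v = y \<bullet> y" using adj[OF v] by (simp add: v_def)
  hence vv: "v \<bullet> v = (\<Sum>i<n. (y $ i)\<^sup>2)"
    using y(1) by (simp add: scalar_prod_def power2_eq_square atLeast0LessThan)
  have "transpose_mat P *\<^sub>v (A *\<^sub>v (P *\<^sub>v y)) = transpose_mat P * A * P *\<^sub>v y"
    by (simp only: assoc_mult_mat_vec[OF mult_carrier_mat[OF PT A(1)] P(1) y(1)]
        assoc_mult_mat_vec[OF PT A(1) mult_mat_vec_carrier[OF P(1) y(1)]])
  also have "\<dots> = vec n (\<lambda>i. es ! i * y $ i)"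
  proof (rule eq_vecI)
    fix i assume "i < dim_vec (vec n (\<lambda>i. es ! i * y $ i))"
    hence i: "i < n" by simp
    have "(mat n n (\<lambda>(i, j). if i = j then es ! i else 0) *\<^sub>v y) $ i
        = (\<Sum>j<n. (if i = j then es ! i else 0) * y $ j)"
      using i y(1) by (simp add: scalar_prod_def atLeast0LessThan)
    also have "\<dots> = (\<Sum>j<n. if i = j then es ! i * y $ i else 0)"
      by (rule sum.cong) auto
    also have "\<dots> = es ! i * y $ i" using i by simp
    finally have "(mat n n (\<lambda>(i, j). if i = j then es ! i else 0) *\<^sub>v y) $ i = es ! i * y $ i" .
    thus "(transpose_mat P * A * P *\<^sub>v y) $ i = vec n (\<lambda>i. es ! i * y $ i) $ i"
      using i by (simp add: P(3))
  qed (simp add: P(3))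
  finally have "v \<bullet> (A *\<^sub>v v) = y \<bullet> vec n (\<lambda>i. es ! i * y $ i)"
    using adj[of "A *\<^sub>v v"] A(1) v by (simp add: v_def)
  hence vAv: "v \<bullet> (A *\<^sub>v v) = (\<Sum>i<n. es ! i * (y $ i)\<^sup>2)"
    by (simp add: scalar_prod_def power2_eq_square atLeast0LessThan mult_ac)
  show ?thesis
  proof (rule that[OF v])
    obtain i where "i < n" "y $ i \<noteq> 0"
      using y(1,2) by (metis eq_vecI carrier_vecD index_zero_vec)
    thus "v \<bullet> v > 0"
      unfolding vv by (intro sum_pos2[of _ i]) auto
  next
    fix c assume c: "c \<in> set cs"
    hence "c \<in> carrier_vec n" using cs by auto
    thus "c \<bullet> v = 0"
      using yc[OF c] transpose_vec_mult_scalar[OF P(1) y(1)] by (simp add: v_def)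
  next
    fix t assume t: "\<And>i. i \<in> K \<Longrightarrow> t \<le> es ! i"
    show "t * (v \<bullet> v) \<le> v \<bullet> (A *\<^sub>v v)"
      unfolding vv vAv sum_distrib_left
    proof (intro sum_mono)
      fix i assume "i \<in> {..<n}"
      thus "t * (y $ i)\<^sup>2 \<le> es ! i * (y $ i)\<^sup>2"
        using t[of i] y0[of i] by (cases "i \<in> K") (auto intro: mult_right_mono)
    qed
  next
    fix t assume t: "\<And>i. i \<in> K \<Longrightarrow> es ! i \<le> t"
    show "v \<bullet> (A *\<^sub>v v) \<le> t * (v \<bullet> v)"
      unfolding vv vAv sum_distrib_left
    proof (intro sum_mono)
      fix i assume "i \<in> {..<n}"
      thus "es ! i * (y $ i)\<^sup>2 \<le> t * (y $ i)\<^sup>2"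
        using t[of i] y0[of i] by (cases "i \<in> K") (auto intro: mult_right_mono)
    qed
  qed
qed

text \<open>Symmetry makes all complex roots real, so the complex factorisation descends to the
  reals, and the sorted list of roots accounts for every factor.\<close>

lemma char_poly_eigenvalue_list:
  fixes A :: "real mat"
  assumes A: "A \<in> carrier_mat n n" and sym: "transpose_mat A = A"
  shows "char_poly A = (\<Prod>e\<leftarrow>eigenvalue_list A. [:-e, 1:])" "length (eigenvalue_list A) = n"
proof -
  interpret hom: map_poly_inj_comm_ring_hom complex_of_real by unfold_locales auto
  let ?p = "map_poly complex_of_real (char_poly A)"
  obtain as where as: "Polynomial.smult (lead_coeff ?p) (\<Prod>a\<leftarrow>as. [:-a, 1:]) = ?p"
    using fundamental_theorem_algebra_factorized[of ?p] by auto
  have p: "?p = (\<Prod>a\<leftarrow>as. [:-a, 1:])"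
    using as degree_monic_char_poly[OF A] by simp
  have "a \<in> \<real>" if "a \<in> set as" for a
  proof (rule symmetric_eigenvalue_real[OF A sym])
    show "poly ?p a = 0"
      unfolding p poly_prod_list using that by (auto simp: prod_list_zero_iff intro!: image_eqI[of _ _ a])
  qed
  hence "as = map complex_of_real (map Re as)"
    by (simp add: map_idI)
  then obtain rs where rs: "as = map complex_of_real rs" by blast
  have "?p = (\<Prod>e\<leftarrow>rs. map_poly complex_of_real [:-e, 1:])"
    unfolding p rs by (simp add: o_def)
  also have "\<dots> = map_poly complex_of_real (\<Prod>e\<leftarrow>rs. [:-e, 1:])"
    unfolding hom.hom_prod_list by (simp only: map_map o_def)
  finally have q: "char_poly A = (\<Prod>e\<leftarrow>rs. [:-e, 1:])" by simp
  have "proots (char_poly A) = (\<Sum>e\<leftarrow>rs. {#e#})"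
    unfolding q using proots_prod_list[of "map (\<lambda>e. [:-e, 1:]) rs"] by (force simp: o_def)
  hence m: "mset (eigenvalue_list A) = mset (rs)"
    by (simp add: eigenvalue_list_def)
  have "(\<Prod>e\<leftarrow>eigenvalue_list A. [:-e, 1:]) = (\<Prod>e\<in>#mset (eigenvalue_list A). [:-e, 1:])"
    by (metis mset_map prod_mset_prod_list)
  also have "\<dots> = char_poly A"
    unfolding m q by (metis mset_map prod_mset_prod_list)
  finally show r: "char_poly A = (\<Prod>e\<leftarrow>eigenvalue_list A. [:-e, 1:])" by simp
  show "length (eigenvalue_list A) = n"
    using degree_linear_factors[of uminus "eigenvalue_list A"] degree_monic_char_poly[OF A] r by simp
qed

lemma eigenvalue_list_antimono:
  assumes "i \<le> j" "j < length (eigenvalue_list A)"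
  shows "eigenvalue_list A ! j \<le> eigenvalue_list A ! i"
  using assms unfolding eigenvalue_list_def
  by (auto simp: rev_nth intro!: sorted_nth_mono)

text \<open>The Courant--Fischer vector is taken for the first \<open>length cs + 1\<close>
  eigenvalues to get the upper bound and for the last \<open>length cs + 1\<close> to get the lower
  one; list positions start at 0.\<close>

lemma eigenvalue_list_bounds:
  fixes A :: "real mat"
  assumes A: "A \<in> carrier_mat n n" "transpose_mat A = A"
    and cs: "set cs \<subseteq> carrier_vec n" "length cs < n"
    and bound: "\<And>v. v \<in> carrier_vec n \<Longrightarrow> (\<And>c. c \<in> set cs \<Longrightarrow> c \<bullet> v = 0) \<Longrightarrow>
      \<bar>v \<bullet> (A *\<^sub>v v)\<bar> \<le> t * (v \<bullet> v)"
  shows "eigenvalue_list A ! length cs \<le> t" "- t \<le> eigenvalue_list A ! (n - 1 - length cs)"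
proof -
  note cp = char_poly_eigenvalue_list[OF A]
  let ?es = "eigenvalue_list A" and ?q = "length cs"
  have "{..?q} \<subseteq> {..<n}" "?q < card {..?q}" using cs(2) by auto
  then obtain v where v: "v \<in> carrier_vec n" "v \<bullet> v > 0" "\<And>c. c \<in> set cs \<Longrightarrow> c \<bullet> v = 0"
    "\<And>t. (\<And>i. i \<in> {..?q} \<Longrightarrow> t \<le> ?es ! i) \<Longrightarrow> t * (v \<bullet> v) \<le> v \<bullet> (A *\<^sub>v v)"
    using courant_fischer_vector[OF A cp(1) cs(1), of "{..?q}"] by metis
  have "?es ! ?q * (v \<bullet> v) \<le> t * (v \<bullet> v)"
    using v(4)[of "?es ! ?q"] bound[OF v(1,3)] cs(2) cp(2)
    by (smt (verit) atMost_iff eigenvalue_list_antimono)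
  thus "?es ! ?q \<le> t" using v(2) by simp
next
  note cp = char_poly_eigenvalue_list[OF A]
  let ?es = "eigenvalue_list A" and ?q = "n - 1 - length cs"
  have "{?q..<n} \<subseteq> {..<n}" "length cs < card {?q..<n}" using cs(2) by auto
  then obtain v where v: "v \<in> carrier_vec n" "v \<bullet> v > 0" "\<And>c. c \<in> set cs \<Longrightarrow> c \<bullet> v = 0"
    "\<And>t. (\<And>i. i \<in> {?q..<n} \<Longrightarrow> ?es ! i \<le> t) \<Longrightarrow> v \<bullet> (A *\<^sub>v v) \<le> t * (v \<bullet> v)"
    using courant_fischer_vector[OF A cp(1) cs(1), of "{?q..<n}"] by metis
  have "- t * (v \<bullet> v) \<le> ?es ! ?q * (v \<bullet> v)"
    using v(4)[of "?es ! ?q"] bound[OF v(1,3)] cs(2) cp(2) eigenvalue_list_antimono[of ?q _ A]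
    by fastforce
  thus "- t \<le> ?es ! ?q" using v(2) by (simp only: mult_le_cancel_right)
qed

subsection \<open>Quadratic forms of adjacency matrices\<close>

definition nbrs :: "('a, 'b) pre_digraph \<Rightarrow> 'a \<Rightarrow> 'a set" where
  "nbrs G v = {u. v \<rightarrow>\<^bsub>G\<^esub> u}"

context graph
begin

lemma nbrs_subset: "nbrs G v \<subseteq> verts G"
  unfolding nbrs_def using adj_in_verts by auto

lemma finite_nbrs [simp]: "finite (nbrs G v)"
  using nbrs_subset finite_verts by (rule finite_subset)

lemma nbrs_sym: "u \<in> nbrs G v \<longleftrightarrow> v \<in> nbrs G u"
  unfolding nbrs_def using sym_arcs by (auto simp: symmetric_def dest: symD)

lemma not_in_own_nbrs [simp]: "v \<notin> nbrs G v"
  unfolding nbrs_def using adj_not_same by auto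

lemma card_nbrs_le_out_degree: "card (nbrs G v) \<le> out_degree G v"
proof -
  have "nbrs G v = head G ` out_arcs G v"
    unfolding nbrs_def by (auto simp: arcs_ends_def arc_to_ends_def)
  thus ?thesis unfolding out_degree_def by (simp add: card_image_le[OF finite_out_arcs])
qed

lemma subcubic_card_nbrs_le_3:
  assumes "subcubic G" "v \<in> verts G"
  shows "card (nbrs G v) \<le> 3"
  using card_nbrs_le_out_degree[of v] assms unfolding subcubic_def by force

text \<open>With fewer than half as many linear constraints as vertices, both median eigenvalues lie
  between one that is at most 1 and one that is at least -1. Vectors become functions on the
  vertices, which frees the later arguments from a numbering.\<close>

lemma HL_index_le_1I:
  fixes cs :: "('a \<Rightarrow> real) list"
  assumes cs: "2 * length cs < card (verts G)"
    and bound: "\<And>f :: 'a \<Rightarrow> real. (\<And>c. c \<in> set cs \<Longrightarrow> (\<Sum>v\<in>verts G. c v * f v) = 0) \<Longrightarrow>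
      \<bar>\<Sum>u\<in>verts G. f u * (\<Sum>v\<in>nbrs G u. f v)\<bar> \<le> (\<Sum>v\<in>verts G. (f v)\<^sup>2)"
  shows "HL_index G \<le> 1"
proof -
  obtain vs where vs: "distinct vs" "set vs = verts G"
    using finite_distinct_list[OF finite_verts] by auto
  define n where "n = card (verts G)"
  have n: "length vs = n" using distinct_card[OF vs(1)] vs(2) by (simp add: n_def)
  define A where "A = adjacency_matrix G vs"
  have A: "A \<in> carrier_mat n n" using adjacency_matrix_carrier[of G vs] by (simp add: A_def n)
  have entry: "A $$ (i, j) = (if vs ! j \<in> nbrs G (vs ! i) then 1 else 0)" if "i < n" "j < n" for i j
    using that by (simp add: A_def adjacency_matrix_def n nbrs_def)
  have sym: "transpose_mat A = A"
    using A nbrs_sym by (intro eq_matI) (auto simp: entry)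
  have bij: "bij_betw ((!) vs) {..<n} (verts G)"
    using bij_betw_nth[OF vs(1), of "{..<n}" "verts G"] vs(2) n by auto
  have sum_verts: "(\<Sum>x\<in>verts G. g x) = (\<Sum>i<n. g (vs ! i))" for g :: "'a \<Rightarrow> real"
    by (rule sum.reindex_bij_betw[OF bij, symmetric])
  define ws where "ws = map (\<lambda>c. vec n (\<lambda>i. c (vs ! i))) cs"
  have ws: "set ws \<subseteq> carrier_vec n" "length ws < n" "length ws = length cs"
    using cs by (auto simp: ws_def n_def)
  have quad: "\<bar>v \<bullet> (A *\<^sub>v v)\<bar> \<le> 1 * (v \<bullet> v)"
    if v: "v \<in> carrier_vec n" "\<And>c. c \<in> set ws \<Longrightarrow> c \<bullet> v = 0" for v
  proof -
    define f where "f x = v $ the_inv_into {..<n} ((!) vs) x" for x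
    have f: "f (vs ! i) = v $ i" if "i < n" for i
      using that bij by (simp add: f_def the_inv_into_f_f bij_betw_def)
    have "(\<Sum>x\<in>verts G. c x * f x) = 0" if "c \<in> set cs" for c
    proof -
      have "vec n (\<lambda>i. c (vs ! i)) \<bullet> v = 0"
        using that by (intro v(2)) (auto simp: ws_def)
      thus ?thesis using v(1) by (simp add: sum_verts f scalar_prod_def atLeast0LessThan)
    qed
    hence "\<bar>\<Sum>u\<in>verts G. f u * (\<Sum>v\<in>nbrs G u. f v)\<bar> \<le> (\<Sum>v\<in>verts G. (f v)\<^sup>2)"
      by (rule bound)
    moreover have "(\<Sum>v\<in>verts G. (f v)\<^sup>2) = v \<bullet> v"
      using v(1) by (simp add: sum_verts f scalar_prod_def atLeast0LessThan power2_eq_square)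
    moreover have "(\<Sum>u\<in>verts G. f u * (\<Sum>v\<in>nbrs G u. f v)) = v \<bullet> (A *\<^sub>v v)"
    proof -
      have "(\<Sum>v\<in>nbrs G (vs ! i). f v) = (A *\<^sub>v v) $ i" if i: "i < n" for i
      proof -
        have "(\<Sum>v\<in>nbrs G (vs ! i). f v) = (\<Sum>v\<in>verts G. if v \<in> nbrs G (vs ! i) then f v else 0)"
          using nbrs_subset[of "vs ! i"] by (subst sum.inter_restrict[symmetric]) (auto simp: Int_absorb1)
        also have "\<dots> = (A *\<^sub>v v) $ i"
          using v(1) i A by (auto simp: sum_verts f scalar_prod_def atLeast0LessThan entry intro!: sum.cong)
        finally show ?thesis .
      qed
      thus ?thesis
        using v(1) A by (simp add: sum_verts f scalar_prod_def[of v] atLeast0LessThan)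
    qed
    ultimately show ?thesis by simp
  qed
  let ?es = "eigenvalue_list A" and ?q = "length cs"
  note b = eigenvalue_list_bounds[OF A sym ws(1,2) quad, unfolded ws(3)]
  have len: "length ?es = n" by (rule char_poly_eigenvalue_list[OF A sym])
  define h where "h = (n + 1) div 2"
  define l where "l = n div 2 + 1"
  have h: "nat \<lfloor>(real n + 1) / 2\<rfloor> = h"
    using floor_divide_of_nat_eq[of "n + 1" 2, where 'a = real] by (simp add: h_def add.commute)
  have l: "nat \<lceil>(real n + 1) / 2\<rceil> = l"
  proof -
    have "real n = 2 * real (n div 2) + real (n mod 2)"
      by (metis mult_div_mod_eq of_nat_add of_nat_mult of_nat_numeral)
    moreover have "n mod 2 \<le> 1" by simp
    ultimately have "\<lceil>(real n + 1) / 2\<rceil> = int (n div 2 + 1)"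
      by (intro ceiling_unique) (auto simp: field_simps)
    thus ?thesis by (simp add: l_def)
  qed
  have q: "2 * ?q < n" using cs by (simp add: n_def)
  \<comment> \<open>Since \<open>2 * ?q < n\<close>, the positions counted from 0 satisfy
    \<open>?q \<le> h - 1 \<le> l - 1 \<le> n - 1 - ?q\<close>.\<close>
  have "?es ! (h - 1) \<le> ?es ! ?q" "?es ! (l - 1) \<le> ?es ! (h - 1)"
    "?es ! (n - 1 - ?q) \<le> ?es ! (l - 1)"
    using q by (auto simp: h_def l_def len intro!: eigenvalue_list_antimono)
  hence "\<bar>?es ! (h - 1)\<bar> \<le> 1" "\<bar>?es ! (l - 1)\<bar> \<le> 1" using b by auto
  thus ?thesis
    by (simp add: HL_index_def Let_def n_def[symmetric] h l graph_eigenvalue_def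
        graph_eigenvalues_enum[OF vs] A_def[symmetric])
qed

section \<open>Quadratic forms on induced matchings\<close>

lemma sum_nbrs_swap:
  fixes g :: "'a \<Rightarrow> 'a \<Rightarrow> 'c :: comm_monoid_add"
  assumes "finite S" "finite T"
  shows "(\<Sum>u\<in>S. \<Sum>v\<in>nbrs G u \<inter> T. g u v) = (\<Sum>v\<in>T. \<Sum>u\<in>nbrs G v \<inter> S. g u v)"
proof -
  have "nbrs G u \<inter> T = {v \<in> T. v \<in> nbrs G u}" "nbrs G u \<inter> S = {v \<in> S. u \<in> nbrs G v}" for u
    using nbrs_sym by auto
  thus ?thesis using sum.swap_restrict[OF assms, of g "\<lambda>u v. v \<in> nbrs G u"] by simp
qed

text \<open>Each product is at most half the sum of the two squares, and a vertex occurs at most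
  once as first and at most once as second member of an ordered adjacent pair.\<close>

lemma matching_quadratic_form_le:
  fixes f :: "'a \<Rightarrow> real"
  assumes S: "finite S" "\<And>u. u \<in> S \<Longrightarrow> card (nbrs G u \<inter> S) \<le> 1"
  shows "\<bar>\<Sum>u\<in>S. f u * (\<Sum>v\<in>nbrs G u \<inter> S. f v)\<bar> \<le> (\<Sum>u\<in>S. (f u)\<^sup>2)"
proof -
  have amgm: "\<bar>x * y\<bar> \<le> x\<^sup>2 / 2 + y\<^sup>2 / 2" for x y :: real
    using sum_squares_bound[of "\<bar>x\<bar>" "\<bar>y\<bar>"] by (simp add: abs_mult)
  have deg: "(\<Sum>u\<in>S. \<Sum>v\<in>nbrs G u \<inter> S. (f u)\<^sup>2 / 2) \<le> (\<Sum>u\<in>S. (f u)\<^sup>2 / 2)"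
  proof (rule sum_mono)
    fix u assume "u \<in> S"
    hence "real (card (nbrs G u \<inter> S)) * ((f u)\<^sup>2 / 2) \<le> 1 * ((f u)\<^sup>2 / 2)"
      using S(2)[of u] by (intro mult_right_mono) auto
    thus "(\<Sum>v\<in>nbrs G u \<inter> S. (f u)\<^sup>2 / 2) \<le> (f u)\<^sup>2 / 2" by simp
  qed
  have "\<bar>\<Sum>u\<in>S. f u * (\<Sum>v\<in>nbrs G u \<inter> S. f v)\<bar> \<le> (\<Sum>u\<in>S. \<Sum>v\<in>nbrs G u \<inter> S. \<bar>f u * f v\<bar>)"
    unfolding sum_distrib_left by (intro order_trans[OF sum_abs] sum_mono sum_abs)
  also have "\<dots> \<le> (\<Sum>u\<in>S. \<Sum>v\<in>nbrs G u \<inter> S. (f u)\<^sup>2 / 2 + (f v)\<^sup>2 / 2)"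
    by (intro sum_mono amgm)
  also have "\<dots> = 2 * (\<Sum>u\<in>S. \<Sum>v\<in>nbrs G u \<inter> S. (f u)\<^sup>2 / 2)"
    using sum_nbrs_swap[OF S(1) S(1), of "\<lambda>u v. (f v)\<^sup>2 / 2"] by (simp add: sum.distrib)
  also have "\<dots> \<le> 2 * (\<Sum>u\<in>S. (f u)\<^sup>2 / 2)"
    using deg by simp
  finally show ?thesis by (simp add: sum_distrib_left)
qed

text \<open>One constraint per vertex outside \<open>S\<close> confines the vectors to
  \<open>S\<close>, where only edges inside \<open>S\<close> contribute; \<open>large\<close> makes
  these constraints fewer than half the vertices.\<close>

lemma HL_index_le_1_if_large_matching:
  assumes S: "S \<subseteq> verts G" "\<And>u. u \<in> S \<Longrightarrow> card (nbrs G u \<inter> S) \<le> 1"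
    and large: "card (verts G) < 2 * card S"
  shows "HL_index G \<le> 1"
proof -
  have fin: "finite S" using S(1) finite_verts by (rule finite_subset)
  obtain zs where zs: "set zs = verts G - S" "distinct zs"
    using finite_distinct_list[of "verts G - S"] by auto
  have len: "length zs = card (verts G) - card S"
    using distinct_card[OF zs(2)] zs(1) S(1) fin by (simp add: card_Diff_subset)
  show ?thesis
  proof (rule HL_index_le_1I[of "map (\<lambda>z v. if v = z then 1 else 0) zs"])
    show "2 * length (map (\<lambda>z v. if v = z then 1 else 0 :: real) zs) < card (verts G)"
      using len large card_mono[OF finite_verts S(1)] by simp
  next
    fix f :: "'a \<Rightarrow> real"
    assume f: "\<And>c. c \<in> set (map (\<lambda>z v. if v = z then 1 else 0) zs) \<Longrightarrow> (\<Sum>v\<in>verts G. c v * f v) = 0"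
    have f0: "f z = 0" if "z \<in> verts G - S" for z
      using f[of "\<lambda>v. if v = z then 1 else 0"] that zs(1)
      by (auto simp: if_distrib[of "\<lambda>x. x * _"] cong: if_cong)
    have "(\<Sum>u\<in>verts G. f u * (\<Sum>v\<in>nbrs G u. f v)) = (\<Sum>u\<in>S. f u * (\<Sum>v\<in>nbrs G u \<inter> S. f v))"
      using S(1) f0 nbrs_subset
      by (intro sum.mono_neutral_cong_right) (auto intro!: sum.mono_neutral_cong_right)
    moreover have "(\<Sum>v\<in>verts G. (f v)\<^sup>2) = (\<Sum>v\<in>S. (f v)\<^sup>2)"
      using S(1) f0 by (intro sum.mono_neutral_right) auto
    ultimately show "\<bar>\<Sum>u\<in>verts G. f u * (\<Sum>v\<in>nbrs G u. f v)\<bar> \<le> (\<Sum>v\<in>verts G. (f v)\<^sup>2)"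
      using matching_quadratic_form_le[OF fin S(2), of f] by simp
  qed
qed

text \<open>
  If \<open>a\<close> and \<open>b\<close> have the same neighbours in \<open>S\<close>, then the vector \<open>e\<^sub>a - e\<^sub>b\<close> is decoupled
  from the vectors supported on \<open>S\<close>, and so raises the dimension by one.
\<close>

lemma HL_index_le_1_if_large_matching_and_twins:
  assumes S: "S \<subseteq> verts G" "\<And>u. u \<in> S \<Longrightarrow> card (nbrs G u \<inter> S) \<le> 1"
    and ab: "a \<in> verts G - S" "b \<in> verts G - S" "a \<noteq> b" "nbrs G a \<inter> S = nbrs G b \<inter> S"
    and large: "card (verts G) < 2 * card S + 2"
  shows "HL_index G \<le> 1"
proof -
  have fin: "finite S" using S(1) finite_verts by (rule finite_subset)
  let ?T = "insert a (insert b S)"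
  have T: "?T \<subseteq> verts G" "card ?T = card S + 2" "finite ?T"
    using S(1) ab fin by auto
  obtain zs where zs: "set zs = verts G - ?T" "distinct zs"
    using finite_distinct_list[of "verts G - ?T"] by auto
  have len: "length zs = card (verts G) - (card S + 2)"
    using distinct_card[OF zs(2)] zs(1) T by (simp add: card_Diff_subset del: insert_subset)
  \<comment> \<open>The first functional forces \<open>f b = - f a\<close>, the others remove the
    coordinates outside \<open>?T\<close>. This leaves dimension \<open>card S + 1\<close>.\<close>
  let ?cs = "(\<lambda>v. if v = a \<or> v = b then 1 else 0) # map (\<lambda>z v. if v = z then 1 else 0 :: real) zs"
  show ?thesis
  proof (rule HL_index_le_1I[of ?cs])
    show "2 * length ?cs < card (verts G)"
      using len large card_mono[OF finite_verts T(1)] T(2) by simp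
  next
    fix f :: "'a \<Rightarrow> real"
    assume f: "\<And>c. c \<in> set ?cs \<Longrightarrow> (\<Sum>v\<in>verts G. c v * f v) = 0"
    have f0: "f z = 0" if "z \<in> verts G - ?T" for z
      using f[of "\<lambda>v. if v = z then 1 else 0"] that zs(1)
      by (auto simp: if_distrib[of "\<lambda>x. x * _"] cong: if_cong)
    have "(\<Sum>v\<in>verts G. (if v = a \<or> v = b then 1 else 0) * f v) = (\<Sum>v\<in>{a, b}. f v)"
      using ab by (intro sum.mono_neutral_cong_right) auto
    hence fb: "f b = - f a"
      using f[of "\<lambda>v. if v = a \<or> v = b then 1 else 0"] ab(3) by simp
    have in_T: "(\<Sum>v\<in>nbrs G u. f v) = (\<Sum>v\<in>nbrs G u \<inter> S. f v) + (\<Sum>v\<in>nbrs G u \<inter> {a, b}. f v)" for u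
    proof -
      have "(\<Sum>v\<in>nbrs G u. f v) = (\<Sum>v\<in>(nbrs G u \<inter> S) \<union> (nbrs G u \<inter> {a, b}). f v)"
        using f0 nbrs_subset by (intro sum.mono_neutral_right) auto
      thus ?thesis using ab by (subst (asm) sum.union_disjoint) auto
    qed
    \<comment> \<open>A vertex of \<open>S\<close> is adjacent to both twins or to neither, so their
      values cancel.\<close>
    have "(\<Sum>v\<in>nbrs G u \<inter> {a, b}. f v) = 0" if "u \<in> S" for u
    proof -
      have "a \<in> nbrs G u \<longleftrightarrow> b \<in> nbrs G u" using ab(4) that nbrs_sym by blast
      hence "nbrs G u \<inter> {a, b} = {} \<or> nbrs G u \<inter> {a, b} = {a, b}" by auto
      thus ?thesis using fb ab(3) by auto
    qed
    hence sumS: "(\<Sum>u\<in>S. f u * (\<Sum>v\<in>nbrs G u. f v)) = (\<Sum>u\<in>S. f u * (\<Sum>v\<in>nbrs G u \<inter> S. f v))"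
      by (simp add: in_T)
    \<comment> \<open>An edge between the twins contributes in absolute value just their share
      \<open>2 * (f a)\<^sup>2\<close> of the squared norm.\<close>
    have sumab: "f a * (\<Sum>v\<in>nbrs G a. f v) + f b * (\<Sum>v\<in>nbrs G b. f v)
        = (if b \<in> nbrs G a then - 2 * (f a)\<^sup>2 else 0)"
    proof -
      have "nbrs G a \<inter> {a, b} = (if b \<in> nbrs G a then {b} else {})"
        "nbrs G b \<inter> {a, b} = (if b \<in> nbrs G a then {a} else {})"
        using nbrs_sym by auto
      thus ?thesis by (simp add: in_T ab(4) fb algebra_simps power2_eq_square)
    qed
    have "(\<Sum>u\<in>verts G. f u * (\<Sum>v\<in>nbrs G u. f v)) = (\<Sum>u\<in>?T. f u * (\<Sum>v\<in>nbrs G u. f v))"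
      using T(1) f0 by (intro sum.mono_neutral_right) auto
    also have "\<dots> = (f a * (\<Sum>v\<in>nbrs G a. f v) + f b * (\<Sum>v\<in>nbrs G b. f v))
        + (\<Sum>u\<in>S. f u * (\<Sum>v\<in>nbrs G u. f v))"
      using ab fin by simp
    finally have lhs: "(\<Sum>u\<in>verts G. f u * (\<Sum>v\<in>nbrs G u. f v)) =
        (if b \<in> nbrs G a then - 2 * (f a)\<^sup>2 else 0) + (\<Sum>u\<in>S. f u * (\<Sum>v\<in>nbrs G u \<inter> S. f v))"
      unfolding sumab sumS .
    have "(\<Sum>v\<in>verts G. (f v)\<^sup>2) = (\<Sum>v\<in>?T. (f v)\<^sup>2)"
      using T(1) f0 by (intro sum.mono_neutral_right) auto
    also have "\<dots> = 2 * (f a)\<^sup>2 + (\<Sum>v\<in>S. (f v)\<^sup>2)"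
      using ab fin by (simp add: fb)
    finally have rhs: "(\<Sum>v\<in>verts G. (f v)\<^sup>2) = 2 * (f a)\<^sup>2 + (\<Sum>v\<in>S. (f v)\<^sup>2)" .
    show "\<bar>\<Sum>u\<in>verts G. f u * (\<Sum>v\<in>nbrs G u. f v)\<bar> \<le> (\<Sum>v\<in>verts G. (f v)\<^sup>2)"
      unfolding lhs rhs using matching_quadratic_form_le[OF fin S(2), of f] zero_le_power2[of "f a"]
      by (smt (verit))
  qed
qed

subsection \<open>Maximum cuts\<close>

text \<open>The cut is represented by one side, so each crossing edge is counted once, from its end
  in \<open>A\<close>.\<close>

definition max_cut :: "'a set \<Rightarrow> 'a set \<Rightarrow> bool" where
  "max_cut H A \<longleftrightarrow> A \<subseteq> H \<and> (\<forall>A'\<subseteq>H.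
     (\<Sum>u\<in>A'. card (nbrs G u \<inter> (H - A'))) \<le> (\<Sum>u\<in>A. card (nbrs G u \<inter> (H - A))))"

lemma ex_max_cut:
  assumes "finite H"
  obtains A where "max_cut H A"
proof -
  let ?c = "\<lambda>A. \<Sum>u\<in>A. card (nbrs G u \<inter> (H - A))"
  have "Max (?c ` Pow H) \<in> ?c ` Pow H" using assms by (intro Max_in) auto
  then obtain A where "A \<in> Pow H" "?c A = Max (?c ` Pow H)" by auto
  thus ?thesis
    using assms by (intro that[of A]) (auto simp: max_cut_def)
qed

text \<open>Crossing edges can be counted from either end.\<close>

lemma max_cut_complement:
  assumes "finite H" "max_cut H A"
  shows "max_cut H (H - A)"
proof -
  have "(\<Sum>u\<in>H - A. card (nbrs G u \<inter> (H - (H - A)))) = (\<Sum>u\<in>A. card (nbrs G u \<inter> (H - A)))"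
    using sum_nbrs_swap[of "H - A" A "\<lambda>_ _. 1 :: nat"] assms finite_subset[of A H]
    by (auto simp: max_cut_def double_diff)
  thus ?thesis using assms(2) by (auto simp: max_cut_def)
qed

text \<open>Moving \<open>v\<close> across makes its edges to \<open>H - A\<close> cross and stops
  those to \<open>A\<close> from crossing. The balance is written with sums only, to avoid truncated
  subtraction.\<close>

lemma cut_insert:
  assumes H: "finite H" "A \<subseteq> H" and v: "v \<in> H - A"
  shows "(\<Sum>u\<in>insert v A. card (nbrs G u \<inter> (H - insert v A))) + card (nbrs G v \<inter> A)
    = (\<Sum>u\<in>A. card (nbrs G u \<inter> (H - A))) + card (nbrs G v \<inter> (H - A))"
proof -
  have A: "finite A" using H(2,1) by (rule finite_subset)
  have "card (nbrs G u \<inter> (H - A)) = card (nbrs G u \<inter> (H - insert v A)) + (if v \<in> nbrs G u then 1 else 0)" for u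
  proof (cases "v \<in> nbrs G u")
    case True
    hence "nbrs G u \<inter> (H - A) = insert v (nbrs G u \<inter> (H - insert v A))" using v by auto
    thus ?thesis using True by simp
  next
    case False
    hence "nbrs G u \<inter> (H - A) = nbrs G u \<inter> (H - insert v A)" by auto
    thus ?thesis using False by simp
  qed
  hence "(\<Sum>u\<in>A. card (nbrs G u \<inter> (H - A)))
      = (\<Sum>u\<in>A. card (nbrs G u \<inter> (H - insert v A))) + (\<Sum>u\<in>A. if v \<in> nbrs G u then 1 else 0)"
    by (simp add: sum.distrib)
  moreover have "(\<Sum>u\<in>A. if v \<in> nbrs G u then 1 else 0) = card (nbrs G v \<inter> A)"
  proof -
    have "{u \<in> A. v \<in> nbrs G u} = nbrs G v \<inter> A" using nbrs_sym by auto
    thus ?thesis using A by (simp add: sum.If_cases Int_def)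
  qed
  moreover have "nbrs G v \<inter> (H - insert v A) = nbrs G v \<inter> (H - A)" by auto
  ultimately show ?thesis using v A by simp
qed

text \<open>Moving \<open>v\<close> gains at least as many crossing edges as it loses.\<close>

lemma max_cut_insert:
  assumes "finite H" "max_cut H A" "v \<in> H - A" "card (nbrs G v \<inter> A) \<le> card (nbrs G v \<inter> (H - A))"
  shows "max_cut H (insert v A)"
proof -
  have A: "A \<subseteq> H" using assms(2) by (simp add: max_cut_def)
  have "(\<Sum>u\<in>A. card (nbrs G u \<inter> (H - A))) \<le> (\<Sum>u\<in>insert v A. card (nbrs G u \<inter> (H - insert v A)))"
    using cut_insert[OF assms(1) A assms(3)] assms(4) by linarith
  thus ?thesis
    using A assms(2,3) unfolding max_cut_def by (meson DiffD1 insert_subset order_trans)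
qed

text \<open>Otherwise moving \<open>v\<close> across would enlarge the cut.\<close>

lemma max_cut_card_nbrs_le:
  assumes "finite H" "max_cut H A" "v \<in> H - A"
  shows "card (nbrs G v \<inter> (H - A)) \<le> card (nbrs G v \<inter> A)"
proof -
  have "insert v A \<subseteq> H" using assms by (auto simp: max_cut_def)
  hence "(\<Sum>u\<in>insert v A. card (nbrs G u \<inter> (H - insert v A))) \<le> (\<Sum>u\<in>A. card (nbrs G u \<inter> (H - A)))"
    using assms(2) unfolding max_cut_def by blast
  thus ?thesis using cut_insert[OF assms(1) _ assms(3)] assms(2) unfolding max_cut_def by linarith
qed

text \<open>\<open>v\<close> has at least as many neighbours across the cut as on its own side, so
  two on its own side would give it degree at least 4.\<close>

lemma subcubic_max_cut_card_nbrs_le_1: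
  assumes "subcubic G" "finite H" "max_cut H A" "v \<in> A" "H \<subseteq> verts G"
  shows "card (nbrs G v \<inter> A) \<le> 1"
proof -
  have A: "A \<subseteq> H" "H - (H - A) = A" using assms(3) by (auto simp: max_cut_def)
  have "card (nbrs G v \<inter> A) \<le> card (nbrs G v \<inter> (H - A))"
    using max_cut_card_nbrs_le[OF assms(2) max_cut_complement[OF assms(2,3)], of v] assms(4) A by auto
  moreover have "card (nbrs G v \<inter> A) + card (nbrs G v \<inter> (H - A)) = card (nbrs G v \<inter> A \<union> nbrs G v \<inter> (H - A))"
    by (rule card_Un_disjoint[symmetric]) auto
  moreover have "card (nbrs G v \<inter> A \<union> nbrs G v \<inter> (H - A)) \<le> card (nbrs G v)"
    by (rule card_mono) auto
  moreover have "card (nbrs G v) \<le> 3"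
    using assms A(1) by (intro subcubic_card_nbrs_le_3) auto
  ultimately show ?thesis by linarith
qed

section \<open>The cut argument around a copy of \<open>K_{2,3}\<close>\<close>

lemma HL_index_le_1_if_K23:
  assumes sub: "subcubic G"
    and UV: "U \<subseteq> verts G" "V \<subseteq> verts G" "U \<inter> V = {}" "card U = 2" "card V = 3"
    and edges: "\<And>u v. u \<in> U \<Longrightarrow> v \<in> V \<Longrightarrow> v \<in> nbrs G u"
  shows "HL_index G \<le> 1"
proof -
  note deg = subcubic_card_nbrs_le_3[OF sub]
  have fin: "finite U" "finite V" using finite_subset[OF UV(1)] finite_subset[OF UV(2)] by auto
  \<comment> \<open>The three vertices of \<open>V\<close> exhaust the degree of
    \<open>u\<close>.\<close>
  have nU: "nbrs G u = V" if "u \<in> U" for u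
    using edges[OF that] deg[of u] UV(1,5) that by (intro card_seteq[symmetric]) auto
  have UnV: "U \<subseteq> nbrs G v" if "v \<in> V" for v
    using edges that nbrs_sym by blast
  \<comment> \<open>Both vertices of \<open>U\<close> are neighbours of \<open>v\<close>, which
    leaves room for one more.\<close>
  have nV: "card (nbrs G v - U) \<le> 1" if "v \<in> V" for v
    using UnV[OF that] deg[of v] UV(2,4) fin that by (simp add: card_Diff_subset subset_iff)
  obtain a b where ab: "U = {a, b}" "a \<noteq> b" using UV(4) by (auto simp: card_2_iff)
  define H where "H = verts G - (U \<union> V)"
  have H: "finite H" "H \<subseteq> verts G" "H \<inter> U = {}" "H \<inter> V = {}" by (auto simp: H_def)
  have "card (U \<union> V) = 5" using UV fin by (simp add: card_Un_disjoint)
  moreover have "card (U \<union> V) \<le> card (verts G)" using UV(1,2) finite_verts by (intro card_mono) auto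
  ultimately have cardH: "card (verts G) = card H + 5"
    using UV(1,2) fin by (simp add: H_def card_Diff_subset)
  have HU: "nbrs G u \<inter> U = {}" if "u \<in> H" for u
    using nU nbrs_sym H(4) that by blast
  have AU: "A \<union> U \<subseteq> verts G" "card (A \<union> U) = card A + 2"
    "\<And>u. u \<in> A \<union> U \<Longrightarrow> card (nbrs G u \<inter> (A \<union> U)) \<le> 1" if A: "max_cut H A" for A
  proof -
    have AH: "A \<subseteq> H" using A by (simp add: max_cut_def)
    thus "A \<union> U \<subseteq> verts G" using H(2) UV(1) by auto
    have "finite A" using AH H(1) by (rule finite_subset)
    thus "card (A \<union> U) = card A + 2"
      using AH H(3) fin UV(4) by (subst card_Un_disjoint) auto
    fix u assume u: "u \<in> A \<union> U"
    show "card (nbrs G u \<inter> (A \<union> U)) \<le> 1"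
    proof (cases "u \<in> U")
      case True
      hence "nbrs G u \<inter> (A \<union> U) = {}" using nU AH H(4) UV(3) by auto
      thus ?thesis by simp
    next
      case False
      hence "u \<in> A" using u by simp
      moreover from this have "nbrs G u \<inter> (A \<union> U) = nbrs G u \<inter> A" using HU AH by auto
      ultimately show ?thesis
        using subcubic_max_cut_card_nbrs_le_1[OF sub H(1) A _ H(2)] by simp
    qed
  qed
  have matching_U: ?thesis if A: "max_cut H A" "card (verts G) < 2 * card A + 4" for A
    using A(2) by (intro HL_index_le_1_if_large_matching[OF AU(1,3)[OF A(1)]]) (auto simp: AU(2)[OF A(1)])
  obtain A where A: "max_cut H A" "card H \<le> 2 * card A"
  proof -
    obtain A0 where A0: "max_cut H A0" using ex_max_cut[OF H(1)] .
    have "card A0 + card (H - A0) = card H"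
      using A0 H(1) by (metis card_Diff_subset card_mono finite_subset le_add_diff_inverse max_cut_def)
    hence "card H \<le> 2 * card A0 \<or> card H \<le> 2 * card (H - A0)" by linarith
    thus ?thesis using A0 max_cut_complement[OF H(1) A0] that by blast
  qed
  define B where "B = H - A"
  have B: "max_cut H B" using max_cut_complement[OF H(1) A(1)] by (simp add: B_def)
  have AH: "A \<subseteq> H" and BH: "B \<subseteq> H" using A(1) by (auto simp: B_def max_cut_def)
  have finAB: "finite A" "finite B" using AH BH H(1) finite_subset by auto
  have cardB: "card A + card B = card H"
    using AH H(1) by (simp add: B_def card_Diff_subset finAB card_mono)
  note degB = subcubic_max_cut_card_nbrs_le_1[OF sub H(1) B _ H(2)]
  \<comment> \<open>The vector \<open>e\<^sub>x - e\<^sub>y\<close> is decoupled from \<open>A\<close> and from both vertices of \<open>U\<close>.\<close>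
  have two_free: ?thesis if x: "x \<in> V" "y \<in> V" "x \<noteq> y" "nbrs G x \<inter> A = {}" "nbrs G y \<inter> A = {}" for x y
  proof (rule HL_index_le_1_if_large_matching_and_twins[OF AU(1,3)[OF A(1)]])
    show "x \<in> verts G - (A \<union> U)" "y \<in> verts G - (A \<union> U)" "x \<noteq> y"
      using x AH H(4) UV(2,3) by auto
    show "nbrs G x \<inter> (A \<union> U) = nbrs G y \<inter> (A \<union> U)"
      using x UnV[of x] UnV[of y] by auto
    show "card (verts G) < 2 * card (A \<union> U) + 2" using A cardH by (simp add: AU(2))
  qed
  have two_bound: ?thesis if V: "V = {x, y, z}" and x: "nbrs G x \<inter> A \<noteq> {}" "nbrs G y \<inter> A \<noteq> {}" for x y z
  proof (cases "card (verts G) < 2 * card A + 4")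
    case True
    thus ?thesis by (rule matching_U[OF A(1)])
  next
    case False
    hence large: "card (verts G) < 2 * (card B + 3) + 2" using cardB cardH A(2) by presburger
    have outer: "nbrs G w - U \<subseteq> A" if w: "w \<in> V" "nbrs G w \<inter> A \<noteq> {}" for w
    proof -
      obtain w' where w': "w' \<in> nbrs G w" "w' \<in> A" using w(2) by auto
      hence w'U: "w' \<in> nbrs G w - U" using AH H(3) by auto
      have unique: "\<forall>u\<in>nbrs G w - U. \<forall>v\<in>nbrs G w - U. u = v"
        using nV[OF w(1)] card_le_Suc0_iff_eq[of "nbrs G w - U"] by simp
      show ?thesis
      proof
        fix v assume "v \<in> nbrs G w - U"
        hence "v = w'" using unique w'U by (metis (no_types))
        thus "v \<in> A" using w'(2) by simp
      qed
    qed
    let ?S = "B \<union> V"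
    have S_xy: "nbrs G w \<inter> ?S = {}" if "w \<in> {x, y}" for w
    proof -
      have "nbrs G w - U \<subseteq> A" using that x V by (intro outer) auto
      moreover have "A \<inter> ?S = {}" "U \<inter> ?S = {}"
        using AH BH H(3,4) UV(3) by (auto simp: B_def)
      ultimately show ?thesis by blast
    qed
    have S_z: "nbrs G z \<inter> ?S = nbrs G z \<inter> B"
    proof -
      have "x \<notin> nbrs G z" "y \<notin> nbrs G z"
        using S_xy[of x] S_xy[of y] V nbrs_sym by auto
      thus ?thesis using V by auto
    qed
    show ?thesis
    proof (cases "\<exists>u\<in>B. z \<in> nbrs G u \<and> nbrs G u \<inter> B \<noteq> {}")
      case True
      then obtain u where u: "u \<in> B" "z \<in> nbrs G u" "nbrs G u \<inter> B \<noteq> {}" by blast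
      have zH: "z \<notin> H" using V H(4) by auto
      have "card (insert z (nbrs G u \<inter> A \<union> nbrs G u \<inter> B)) \<le> card (nbrs G u)"
        using u by (intro card_mono) auto
      moreover have "z \<notin> nbrs G u \<inter> A \<union> nbrs G u \<inter> B" using zH AH BH by auto
      moreover have "card (nbrs G u \<inter> A \<union> nbrs G u \<inter> B) = card (nbrs G u \<inter> A) + card (nbrs G u \<inter> B)"
        by (rule card_Un_disjoint) (auto simp: B_def)
      moreover have "card (nbrs G u) \<le> 3" using u BH H(2) by (intro deg) auto
      moreover have "card (nbrs G u \<inter> B) > 0" using u by (simp add: card_gt_0_iff)
      ultimately have "card (nbrs G u \<inter> A) \<le> card (nbrs G u \<inter> B)" by simp
      \<comment> \<open>Moving \<open>u\<close> across preserves maximality because the neighbour \<open>z\<close> of \<open>u\<close> lies outside \<open>H\<close>.\<close>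
      hence "max_cut H (insert u A)"
        using u by (intro max_cut_insert[OF H(1) A(1)]) (auto simp: B_def)
      moreover have "card (insert u A) = card A + 1" using u finAB by (simp add: B_def)
      ultimately show ?thesis using A(2) cardH by (intro matching_U[of "insert u A"]) auto
    next
      case False
      show ?thesis
      proof (rule HL_index_le_1_if_large_matching_and_twins)
        show "?S \<subseteq> verts G" using BH H(2) UV(2) by auto
        show "a \<in> verts G - ?S" "b \<in> verts G - ?S" "a \<noteq> b"
          using ab UV(1,3) BH H(3) by auto
        show "nbrs G a \<inter> ?S = nbrs G b \<inter> ?S" using nU ab by simp
        have "card ?S = card B + 3"
          using BH H(4) finAB fin UV(5) by (subst card_Un_disjoint) auto
        thus "card (verts G) < 2 * card ?S + 2" using large by simp
        fix u assume u: "u \<in> ?S"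
        consider "u \<in> {x, y}" | "u = z" | "u \<in> B" using u V by auto
        thus "card (nbrs G u \<inter> ?S) \<le> 1"
        proof cases
          case 1
          thus ?thesis using S_xy by simp
        next
          case 2
          have "card (nbrs G z \<inter> B) \<le> card (nbrs G z - U)"
            using BH H(3) by (intro card_mono) auto
          thus ?thesis using 2 S_z nV[of z] V by simp
        next
          case 3
          hence "x \<notin> nbrs G u" "y \<notin> nbrs G u"
            using S_xy[of x] S_xy[of y] nbrs_sym by auto
          hence S: "nbrs G u \<inter> ?S = nbrs G u \<inter> B \<union> (nbrs G u \<inter> {z})" using V by auto
          consider "nbrs G u \<inter> B = {}" | "nbrs G u \<inter> {z} = {}" using False 3 by auto
          thus ?thesis
          proof cases
            case 1
            thus ?thesis using card_mono[of "{z}" "nbrs G u \<inter> {z}"] by (simp add: S)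
          next
            case 2
            thus ?thesis using degB[OF 3] by (simp only: S Un_empty_right)
          qed
        qed
      qed
    qed
  qed
  obtain x y z where V: "V = {x, y, z}" "x \<noteq> y" "y \<noteq> z" "x \<noteq> z"
    using UV(5) by (auto simp: card_3_iff)
  have V': "V = {x, z, y}" "V = {y, z, x}" using V(1) by auto
  show ?thesis
    using two_free[of x y] two_free[of x z] two_free[of y z]
      two_bound[OF V(1)] two_bound[OF V'(1)] two_bound[OF V'(2)] V by blast
qed

end

theorem theorem1p2:
  fixes G :: "('a, 'b) pre_digraph"
  assumes "graph G"
    and "subcubic G"
    and "\<exists>H. subgraph H G \<and> K\<^bsub>2,3\<^esub> H"
  shows "HL_index G \<le> 1"
proof -
  interpret graph G by fact
  obtain H U V where H: "subgraph H G" "verts H = U \<union> V" "U \<inter> V = {}" "card U = 2" "card V = 3"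
    "arcs_ends H = U \<times> V \<union> V \<times> U"
    using assms(3) unfolding complete_bipartite_digraph_def by blast
  have "arcs_ends H \<subseteq> arcs_ends G"
    using H(1) by (auto simp: subgraph_def compatible_def arcs_ends_conv)
  hence "v \<in> nbrs G u" if "u \<in> U" "v \<in> V" for u v
    using that H(6) by (auto simp: nbrs_def)
  moreover have "U \<subseteq> verts G" "V \<subseteq> verts G" using H(1,2) by (auto simp: subgraph_def)
  ultimately show ?thesis
    using HL_index_le_1_if_K23[OF assms(2)] H(3-5) by blast
qed

end
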